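(* Let $m,d\ge2$ be integers. (i) Let $x^*\in\{1,\dots,m\}$ and let $\{p^{\rm obs}(ab|xy)\}$ be a behavior with a quantum realization $p^{\rm obs}(ab|xy)=\mathrm{Tr}[(M_{a|x}\otimes M_{b|y})\rho_{AB}]$ in which Alice's measurements have compatibility structure $\mathcal{C}_A\supseteq K_{1,m-1}(x^* )$. Then $\{p^{\rm obs}(ab|xy)\}$ does not violate any chain inequality: for all real $\alpha_0,\dots,\alpha_{d-1}$ one has $I_{d,m}\le I_{d,m}^C$. (ii) Consequently, any violation of a chain inequality suffices to certify nonlocality-based randomness: if a quantum behavior $\{p^{\rm obs}(ab|xy)\}\in Q$ satisfies $I_{d,m}>I^C_{d,m}$ for some real $\alpha_0,\dots,\alpha_{d-1}$, then $P^{\rm NL}_{\rm guess}(x^*,y^* )<1$ for all $x^*,y^*\in\{1,\dots,m\}$.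
   Context: $[d]=\{0,\dots,d-1\}$; outcomes $a,b\in[d]$, inputs $x,y\in\{1,\dots,m\}$; arithmetic on outcomes is modulo $d$. $Q$ is the set of behaviors $p(ab|xy)=\mathrm{Tr}[(M_{a|x}\otimes M_{b|y})\rho_{AB}]$ with $\rho_{AB}$ a density operator on a tensor product of two finite-dimensional Hilbert spaces (of arbitrary dimension) and $\{M_{a|x}\}_a$, $\{M_{b|y}\}_b$ POVMs on $A$, $B$. Chain inequality: for $\alpha_0,\dots,\alpha_{d-1}\in\mathbb{R}$, $$I_{d,m}=\sum_{k=0}^{d-1}\alpha_k\sum_{i=1}^m\big[p(A_i-B_i=k)+p(B_i-A_{i+1}=k)\big]\le I^C_{d,m},$$ where $A_x,B_y$ denote the outcomes for inputs $x,y$, $A_{m+1}\equiv A_1+1$, and probabilities of differences are computed modulo $d$: $p(A_i-B_i=k)=\sum_{j\in[d]}p(j+k,j|i,i)$, $p(B_i-A_{i+1}=k)=\sum_{j}p(j,j+k|i+1,i)$ for $i<m$, and $p(B_m-A_{m+1}=k)=\sum_jp(j,j+1+k|1,m)$ (first outcome is Alice's, first input is Alice's). The classical bound is $I^C_{d,m}=\max_{\boldsymbol p\in\mathcal{L}}I_{d,m}$, where $\mathcal{L}$ is the set of local behaviors $\sum_\lambda p(\lambda)p_A(a|x,\lambda)p_B(b|y,\lambda)$. Compatibility: a set of POVMs $\{M_{a|x}\}_{a}$, $x\in S$, is compatible if there are a POVM $\{G_\lambda\}$ and conditional distributions $p(a|x,\lambda)$ with $M_{a|x}=\sum_\lambda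 p(a|x,\lambda)G_\lambda$ for all $a$, $x\in S$. The compatibility structure $\mathcal{C}_A$ is the hypergraph on $\{1,\dots,m\}$ of compatible subsets; $\mathcal{C}_A\supseteq K_{1,m-1}(x^* )$ (star graph centred at $x^*$) means that for every $x'\ne x^*$ the POVMs $x^*$ and $x'$ are compatible. Guessing probability: $P^{\rm NL}_{\rm guess}(x^*,y^* )=\max\sum_{e,e'\in[d]}p^{ee'}(a=e,b=e'|x^*,y^* )$ over families $\{p^{ee'}\}_{e,e'\in[d]}$ of nonnegative multiples of elements of $Q$ with $\sum_{ee'}p^{ee'}(ab|xy)=p^{\rm obs}(ab|xy)$ for all $a,b,x,y$; the maximum equals $1$ means that some feasible family attains the value $1$. *)

theory Defs
  imports "Jordan_Normal_Form.Matrix"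
begin

section \<open>Operators on finite-dimensional Hilbert spaces\<close>

text \<open>Operators on the Hilbert space of dimension n are complex n-by-n matrices.\<close>

definition mat_trace :: "complex mat \<Rightarrow> complex" where
  "mat_trace A = (\<Sum>i<dim_row A. A $$ (i, i))"

definition mat_sum :: "nat \<Rightarrow> ('i \<Rightarrow> complex mat) \<Rightarrow> 'i set \<Rightarrow> complex mat" where
  "mat_sum n E I = mat n n (\<lambda>(i, j). \<Sum>k\<in>I. E k $$ (i, j))"

text \<open>The basis vector with index \<open>i * dim B + j\<close> of the product space is the tensor product of
  the i-th and the j-th basis vector.\<close>

definition tensor_mat :: "complex mat \<Rightarrow> complex mat \<Rightarrow> complex mat" where
  "tensor_mat A B = mat (dim_row A * dim_row B) (dim_col A * dim_col B)
     (\<lambda>(i, j). A $$ (i div dim_row B, j div dim_col B) * B $$ (i mod dim_row B, j mod dim_col B))"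

text \<open>In the order on the complex numbers, \<open>0 \<le> z\<close> says that \<open>z\<close> is real and nonnegative; in
  particular a positive semidefinite matrix is Hermitian.\<close>

definition psd :: "nat \<Rightarrow> complex mat \<Rightarrow> bool" where
  "psd n A \<longleftrightarrow> A \<in> carrier_mat n n \<and> (\<forall>v\<in>carrier_vec n. 0 \<le> (A *\<^sub>v v) \<bullet>c v)"

definition density_operator :: "nat \<Rightarrow> complex mat \<Rightarrow> bool" where
  "density_operator n \<rho> \<longleftrightarrow> psd n \<rho> \<and> mat_trace \<rho> = 1"

definition povm :: "nat \<Rightarrow> nat \<Rightarrow> (nat \<Rightarrow> complex mat) \<Rightarrow> bool" where
  "povm n l E \<longleftrightarrow> (\<forall>k<l. psd n (E k)) \<and> mat_sum n E {..<l} = 1\<^sub>m n"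

definition prob_dist :: "nat \<Rightarrow> (nat \<Rightarrow> real) \<Rightarrow> bool" where
  "prob_dist l q \<longleftrightarrow> (\<forall>k<l. 0 \<le> q k) \<and> (\<Sum>k<l. q k) = 1"


section \<open>Compatibility structures\<close>

text \<open>\<open>M x a\<close> is the effect of outcome \<open>a < d\<close> for input \<open>x\<close>.\<close>

definition compatible :: "nat \<Rightarrow> nat \<Rightarrow> (nat \<Rightarrow> nat \<Rightarrow> complex mat) \<Rightarrow> nat set \<Rightarrow> bool" where
  "compatible d n M S \<longleftrightarrow>
     (\<exists>(l::nat) (G :: nat \<Rightarrow> complex mat) (q :: nat \<Rightarrow> nat \<Rightarrow> nat \<Rightarrow> real).
        povm n l G
      \<and> (\<forall>x\<in>S. \<forall>k<l. prob_dist d (\<lambda>a. q a x k))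
      \<and> (\<forall>x\<in>S. \<forall>a<d. M x a = mat_sum n (\<lambda>k. complex_of_real (q a x k) \<cdot>\<^sub>m G k) {..<l}))"

definition compatibility_structure ::
  "nat \<Rightarrow> nat \<Rightarrow> nat \<Rightarrow> (nat \<Rightarrow> nat \<Rightarrow> complex mat) \<Rightarrow> nat set set" where
  "compatibility_structure d m n M = {S. S \<subseteq> {1..m} \<and> compatible d n M S}"

definition star_graph :: "nat \<Rightarrow> nat \<Rightarrow> nat set set" where
  "star_graph m c = {{c, x} |x. x \<in> {1..m} \<and> x \<noteq> c}"


section \<open>Behaviors\<close>

text \<open>\<open>p a b x y\<close> is the probability of the outcomes \<open>a, b < d\<close> given the inputs
  \<open>x, y \<in> {1..m}\<close>; values outside these ranges carry no meaning and are left unconstrained.\<close>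

type_synonym behavior = "nat \<Rightarrow> nat \<Rightarrow> nat \<Rightarrow> nat \<Rightarrow> real"

definition quantum_realization ::
  "nat \<Rightarrow> nat \<Rightarrow> nat \<Rightarrow> nat \<Rightarrow> (nat \<Rightarrow> nat \<Rightarrow> complex mat) \<Rightarrow> (nat \<Rightarrow> nat \<Rightarrow> complex mat)
     \<Rightarrow> complex mat \<Rightarrow> behavior \<Rightarrow> bool" where
  "quantum_realization d m nA nB MA MB \<rho> p \<longleftrightarrow>
     (\<forall>x\<in>{1..m}. povm nA d (MA x))
   \<and> (\<forall>y\<in>{1..m}. povm nB d (MB y))
   \<and> density_operator (nA * nB) \<rho>
   \<and> (\<forall>a<d. \<forall>b<d. \<forall>x\<in>{1..m}. \<forall>y\<in>{1..m}.
        complex_of_real (p a b x y) = mat_trace (tensor_mat (MA x a) (MB y b) * \<rho>))"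

definition quantum_behaviors :: "nat \<Rightarrow> nat \<Rightarrow> behavior set" where
  "quantum_behaviors d m = {p. \<exists>nA nB MA MB \<rho>. quantum_realization d m nA nB MA MB \<rho> p}"

definition local_behaviors :: "nat \<Rightarrow> nat \<Rightarrow> behavior set" where
  "local_behaviors d m =
     {p. \<exists>(l::nat) (w :: nat \<Rightarrow> real) (PA :: nat \<Rightarrow> nat \<Rightarrow> nat \<Rightarrow> real) (PB :: nat \<Rightarrow> nat \<Rightarrow> nat \<Rightarrow> real).
        prob_dist l w
      \<and> (\<forall>x\<in>{1..m}. \<forall>k<l. prob_dist d (\<lambda>a. PA a x k))
      \<and> (\<forall>y\<in>{1..m}. \<forall>k<l. prob_dist d (\<lambda>b. PB b y k))
      \<and> (\<forall>a<d. \<forall>b<d. \<forall>x\<in>{1..m}. \<forall>y\<in>{1..m}.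
           p a b x y = (\<Sum>k<l. w k * PA a x k * PB b y k))}"


section \<open>Chain inequalities\<close>

definition prob_A_minus_B :: "nat \<Rightarrow> behavior \<Rightarrow> nat \<Rightarrow> nat \<Rightarrow> real" where
  "prob_A_minus_B d p i k = (\<Sum>j<d. p ((j + k) mod d) j i i)"

text \<open>The probability that \<open>B i - A (i + 1) = k\<close>, where \<open>A (m + 1)\<close> is \<open>A 1 + 1\<close>.\<close>

definition prob_B_minus_A :: "nat \<Rightarrow> nat \<Rightarrow> behavior \<Rightarrow> nat \<Rightarrow> nat \<Rightarrow> real" where
  "prob_B_minus_A d m p i k =
     (if i < m then (\<Sum>j<d. p j ((j + k) mod d) (i + 1) i)
      else (\<Sum>j<d. p j ((j + 1 + k) mod d) 1 m))"

definition chain_value :: "nat \<Rightarrow> nat \<Rightarrow> (nat \<Rightarrow> real) \<Rightarrow> behavior \<Rightarrow> real" where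
  "chain_value d m \<alpha> p =
     (\<Sum>k<d. \<alpha> k * (\<Sum>i=1..m. prob_A_minus_B d p i k + prob_B_minus_A d m p i k))"

text \<open>The supremum is a maximum, as the local behaviors form a polytope.\<close>

definition classical_bound :: "nat \<Rightarrow> nat \<Rightarrow> (nat \<Rightarrow> real) \<Rightarrow> real" where
  "classical_bound d m \<alpha> = (SUP p\<in>local_behaviors d m. chain_value d m \<alpha> p)"


section \<open>Guessing probability\<close>

definition guessing_families ::
  "nat \<Rightarrow> nat \<Rightarrow> behavior \<Rightarrow> (nat \<Rightarrow> nat \<Rightarrow> behavior) set" where
  "guessing_families d m p_obs =
     {P. (\<forall>e<d. \<forall>e'<d. \<exists>c\<ge>0. \<exists>q\<in>quantum_behaviors d m.
            \<forall>a<d. \<forall>b<d. \<forall>x\<in>{1..m}. \<forall>y\<in>{1..m}. P e e' a b x y = c * q a b x y)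
       \<and> (\<forall>a<d. \<forall>b<d. \<forall>x\<in>{1..m}. \<forall>y\<in>{1..m}.
            (\<Sum>e<d. \<Sum>e'<d. P e e' a b x y) = p_obs a b x y)}"

definition guessing_score :: "nat \<Rightarrow> nat \<Rightarrow> nat \<Rightarrow> (nat \<Rightarrow> nat \<Rightarrow> behavior) \<Rightarrow> real" where
  "guessing_score d xs ys P = (\<Sum>e<d. \<Sum>e'<d. P e e' e e' xs ys)"

text \<open>The set of quantum behaviors is not closed in general, so attainment of this supremum is not
  automatic. For quantum \<open>p_obs\<close> it is a supremum of a nonempty set of reals in \<open>{0..1}\<close>.\<close>

definition P_guess_NL :: "nat \<Rightarrow> nat \<Rightarrow> behavior \<Rightarrow> nat \<Rightarrow> nat \<Rightarrow> real" where
  "P_guess_NL d m p_obs xs ys = (SUP P\<in>guessing_families d m p_obs. guessing_score d xs ys P)"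

end

theory Submission
  imports Defs
begin

text \<open>Conditioned on the outcome \<open>a\<close> of the central measurement \<open>xs\<close>, the cycle of correlators in the
  chain inequality opens into a path whose two ends are the deterministic value \<open>a\<close>. A path whose
  edge distributions have matching vertex marginals behaves classically, because its edges can be glued
  along a Markov chain; here this is used in the dual form of potentials obtained by dynamic
  programming. Such a conditioning exists when \<open>xs\<close> is compatible with every other measurement.
  It also exists for the decomposition held by a perfectly guessing eavesdropper. As the guessing
  probability is only a supremum, the classical bound is proved with an error linear in the
  probability that the guess of \<open>a\<close> fails, which keeps the supremum away from 1.\<close>

section \<open>Behaviors with a joint central outcome\<close>

lemma path_expectation_le:
  fixes f R :: "nat \<Rightarrow> nat \<Rightarrow> nat \<Rightarrow> real" and r :: "nat \<Rightarrow> nat \<Rightarrow> real"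
  assumes d: "0 < d"
    and nonneg: "\<And>t u v. t < n \<Longrightarrow> u < d \<Longrightarrow> v < d \<Longrightarrow> 0 \<le> R t u v"
    and start: "\<And>t u. t < n \<Longrightarrow> u < d \<Longrightarrow> (\<Sum>v<d. R t u v) = r t u"
    and stop: "\<And>t v. t < n \<Longrightarrow> v < d \<Longrightarrow> (\<Sum>u<d. R t u v) = r (Suc t) v"
    and r0: "\<And>u. u < d \<Longrightarrow> 0 \<le> r 0 u"
    and bound: "\<And>s. (\<And>t. t \<le> n \<Longrightarrow> s t < d) \<Longrightarrow>
      (\<Sum>t<n. f t (s t) (s (Suc t))) \<le> z (s 0) + w (s n)"
  shows "(\<Sum>t<n. \<Sum>u<d. \<Sum>v<d. R t u v * f t u v) \<le> (\<Sum>u<d. r 0 u * z u) + (\<Sum>v<d. r n v * w v)"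
  using nonneg start stop bound
proof (induction n arbitrary: w)
  case 0
  have "0 \<le> r 0 u * (z u + w u)" if "u < d" for u
    using "0.prems"(4)[of "\<lambda>_. u"] that r0 by simp
  then have "0 \<le> (\<Sum>u<d. r 0 u * (z u + w u))" by (intro sum_nonneg) auto
  then show ?case by (simp add: distrib_left sum.distrib)
next
  case (Suc n)
  define w' where "w' u = Min ((\<lambda>v. w v - f n u v) ` {..<d})" for u
  have w'_le: "w' u \<le> w v - f n u v" if "v < d" for u v
    unfolding w'_def using that by (intro Min_le) auto
  have w'_attained: "\<exists>v<d. w' u = w v - f n u v" for u
  proof -
    have "w' u \<in> (\<lambda>v. w v - f n u v) ` {..<d}"
      unfolding w'_def using d by (intro Min_in) auto
    then show ?thesis by auto
  qed
  have IH: "(\<Sum>t<n. \<Sum>u<d. \<Sum>v<d. R t u v * f t u v) \<le> (\<Sum>u<d. r 0 u * z u) + (\<Sum>v<d. r n v * w' v)"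
  proof (rule Suc.IH)
    fix s assume s: "\<And>t. t \<le> n \<Longrightarrow> s t < d"
    obtain v where v: "v < d" "w' (s n) = w v - f n (s n) v" using w'_attained by blast
    have "(\<Sum>t<Suc n. f t ((s(Suc n := v)) t) ((s(Suc n := v)) (Suc t)))
        \<le> z ((s(Suc n := v)) 0) + w ((s(Suc n := v)) (Suc n))"
    proof (rule Suc.prems(4))
      show "(s(Suc n := v)) t < d" if "t \<le> Suc n" for t using that s v by (cases "t = Suc n") auto
    qed
    then show "(\<Sum>t<n. f t (s t) (s (Suc t))) \<le> z (s 0) + w' (s n)"
      using v by simp
  qed (simp_all add: Suc.prems(1-3))
  have "(\<Sum>u<d. \<Sum>v<d. R n u v * f n u v) \<le> (\<Sum>u<d. \<Sum>v<d. R n u v * (w v - w' u))"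
  proof (intro sum_mono)
    fix u v assume "u \<in> {..<d}" "v \<in> {..<d}"
    then show "R n u v * f n u v \<le> R n u v * (w v - w' u)"
      using Suc.prems(1)[of n u v] w'_le[of v u] by (intro mult_left_mono) auto
  qed
  also have "\<dots> = (\<Sum>u<d. \<Sum>v<d. R n u v * w v) - (\<Sum>u<d. \<Sum>v<d. R n u v * w' u)"
    by (simp add: right_diff_distrib sum_subtractf)
  also have "(\<Sum>u<d. \<Sum>v<d. R n u v * w v) = (\<Sum>v<d. r (Suc n) v * w v)"
    by (subst sum.swap) (simp add: sum_distrib_right[symmetric] Suc.prems(3))
  also have "(\<Sum>u<d. \<Sum>v<d. R n u v * w' u) = (\<Sum>u<d. r n u * w' u)"
    by (simp add: sum_distrib_right[symmetric] Suc.prems(2))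
  finally show ?case using IH by simp
qed

lemma add_mod_inverse:
  fixes d j c k :: nat
  assumes "(j + c) mod d = 0" and "k < d"
  shows "((j + k) mod d + c) mod d = k"
proof -
  have "((j + k) mod d + c) mod d = ((j + c) + k) mod d"
    by (simp only: mod_add_left_eq) (simp add: ac_simps)
  also have "\<dots> = ((j + c) mod d + k) mod d"
    by (simp only: mod_add_left_eq)
  finally show ?thesis using assms by simp
qed

lemma bij_betw_add_mod:
  fixes d j :: nat
  assumes "0 < d"
  shows "bij_betw (\<lambda>k. (j + k) mod d) {..<d} {..<d}"
proof -
  have "(j + (d - j mod d)) mod d = (j mod d + (d - j mod d)) mod d"
    by (simp only: mod_add_left_eq)
  also have "\<dots> = 0" using assms mod_less_divisor[of d j] by simp
  finally have c: "(j + (d - j mod d)) mod d = 0" .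
  have "inj_on (\<lambda>k. (j + k) mod d) {..<d}"
  proof (rule inj_on_inverseI)
    show "((j + k) mod d + (d - j mod d)) mod d = k" if "k \<in> {..<d}" for k
      by (rule add_mod_inverse[OF c]) (use that in simp)
  qed
  moreover have "(\<lambda>k. (j + k) mod d) ` {..<d} \<subseteq> {..<d}" using assms by auto
  ultimately show ?thesis unfolding bij_betw_def by (metis endo_inj_surj finite_lessThan)
qed

lemma sum_add_mod:
  fixes d j :: nat and g :: "nat \<Rightarrow> 'a::comm_monoid_add"
  assumes "0 < d"
  shows "(\<Sum>k<d. g ((j + k) mod d)) = (\<Sum>k<d. g k)"
  using sum.reindex_bij_betw[OF bij_betw_add_mod[OF assms]] .

lemma sum_mult_add_mod:
  fixes d j c :: nat and F G :: "nat \<Rightarrow> real"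
  assumes "0 < d" and "(j + c) mod d = 0"
  shows "(\<Sum>k<d. F k * G ((j + k) mod d)) = (\<Sum>a<d. G a * F ((a + c) mod d))"
proof -
  have "((j + k) mod d + c) mod d = k" if "k < d" for k
    using add_mod_inverse assms(2) that .
  then have "(\<Sum>k<d. F k * G ((j + k) mod d))
      = (\<Sum>k<d. G ((j + k) mod d) * F (((j + k) mod d + c) mod d))"
    by (intro sum.cong) auto
  then show ?thesis
    using sum_add_mod[OF assms(1), of "\<lambda>a. G a * F ((a + c) mod d)" j] by simp
qed

definition coeff_AB :: "nat \<Rightarrow> (nat \<Rightarrow> real) \<Rightarrow> nat \<Rightarrow> nat \<Rightarrow> real" where
  "coeff_AB d \<alpha> a b = \<alpha> ((a + (d - b)) mod d)"

definition coeff_BA :: "nat \<Rightarrow> nat \<Rightarrow> (nat \<Rightarrow> real) \<Rightarrow> nat \<Rightarrow> nat \<Rightarrow> nat \<Rightarrow> real" where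
  "coeff_BA d m \<alpha> i a b = \<alpha> ((b + (if i < m then d - a else 2 * d - Suc a)) mod d)"

definition next_input :: "nat \<Rightarrow> nat \<Rightarrow> nat" where
  "next_input m i = i mod m + 1"

lemma next_input_range: "0 < m \<Longrightarrow> next_input m i \<in> {1..m}"
  by (simp add: next_input_def Suc_le_eq)

lemma chain_value_eq:
  assumes d: "0 < d"
  shows "chain_value d m \<alpha> p =
    (\<Sum>i=1..m. (\<Sum>a<d. \<Sum>b<d. p a b i i * coeff_AB d \<alpha> a b)
            + (\<Sum>a<d. \<Sum>b<d. p a b (next_input m i) i * coeff_BA d m \<alpha> i a b))"
proof -
  have AB: "(\<Sum>k<d. \<alpha> k * prob_A_minus_B d p i k) = (\<Sum>a<d. \<Sum>b<d. p a b i i * coeff_AB d \<alpha> a b)" for i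
  proof -
    have "(\<Sum>k<d. \<alpha> k * prob_A_minus_B d p i k) = (\<Sum>j<d. \<Sum>k<d. \<alpha> k * p ((j + k) mod d) j i i)"
      unfolding prob_A_minus_B_def by (subst sum.swap) (simp add: sum_distrib_left)
    also have "\<dots> = (\<Sum>j<d. \<Sum>a<d. p a j i i * coeff_AB d \<alpha> a j)"
      unfolding coeff_AB_def
      by (rule sum.cong[OF refl], rule sum_mult_add_mod[OF d, where F = \<alpha> and G = "\<lambda>a. p a _ i i"]) auto
    also have "\<dots> = (\<Sum>a<d. \<Sum>b<d. p a b i i * coeff_AB d \<alpha> a b)"
      by (rule sum.swap)
    finally show ?thesis .
  qed
  have BA: "(\<Sum>k<d. \<alpha> k * prob_B_minus_A d m p i k)
      = (\<Sum>a<d. \<Sum>b<d. p a b (next_input m i) i * coeff_BA d m \<alpha> i a b)" if i: "i \<in> {1..m}" for i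
  proof (cases "i < m")
    case True
    then have "(\<Sum>k<d. \<alpha> k * prob_B_minus_A d m p i k)
        = (\<Sum>j<d. \<Sum>k<d. \<alpha> k * p j ((j + k) mod d) (next_input m i) i)"
      unfolding prob_B_minus_A_def next_input_def
      by (subst sum.swap) (simp add: sum_distrib_left)
    also have "\<dots> = (\<Sum>a<d. \<Sum>b<d. p a b (next_input m i) i * coeff_BA d m \<alpha> i a b)"
      unfolding coeff_BA_def
      by (rule sum.cong[OF refl], rule sum_mult_add_mod[OF d, where F = \<alpha> and G = "\<lambda>b. p _ b (next_input m i) i"])
        (use True in auto)
    finally show ?thesis .
  next
    case False
    then have "i = m" using i by simp
    then have "(\<Sum>k<d. \<alpha> k * prob_B_minus_A d m p i k)
        = (\<Sum>j<d. \<Sum>k<d. \<alpha> k * p j ((j + 1 + k) mod d) (next_input m i) i)"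
      unfolding prob_B_minus_A_def next_input_def
      by (subst sum.swap) (simp add: sum_distrib_left)
    also have "\<dots> = (\<Sum>a<d. \<Sum>b<d. p a b (next_input m i) i * coeff_BA d m \<alpha> i a b)"
      unfolding coeff_BA_def
      by (rule sum.cong[OF refl], rule sum_mult_add_mod[OF d, where F = \<alpha> and G = "\<lambda>b. p _ b (next_input m i) i"])
        (use False in auto)
    finally show ?thesis .
  qed
  have "chain_value d m \<alpha> p = (\<Sum>i=1..m. (\<Sum>k<d. \<alpha> k * prob_A_minus_B d p i k)
      + (\<Sum>k<d. \<alpha> k * prob_B_minus_A d m p i k))"
    unfolding chain_value_def
    by (simp add: sum_distrib_left sum.distrib distrib_left)
      (intro arg_cong2[of _ _ _ _ "(+)"] sum.swap)
  then show ?thesis using AB BA by simp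
qed

lemma abs_coeff_le:
  assumes "0 < d"
  shows "\<bar>coeff_AB d \<alpha> a b\<bar> \<le> (\<Sum>k<d. \<bar>\<alpha> k\<bar>)" "\<bar>coeff_BA d m \<alpha> i a b\<bar> \<le> (\<Sum>k<d. \<bar>\<alpha> k\<bar>)"
  unfolding coeff_AB_def coeff_BA_def
  by (rule member_le_sum; use assms in simp)+

lemma chain_value_le:
  assumes "0 < d"
    and p: "\<And>a b x y. a < d \<Longrightarrow> b < d \<Longrightarrow> x \<in> {1..m} \<Longrightarrow> y \<in> {1..m} \<Longrightarrow> \<bar>p a b x y\<bar> \<le> 1"
  shows "chain_value d m \<alpha> p \<le> (\<Sum>i=1..m. (\<Sum>a<d. \<Sum>b<d. \<Sum>k<d. \<bar>\<alpha> k\<bar>) + (\<Sum>a<d. \<Sum>b<d. \<Sum>k<d. \<bar>\<alpha> k\<bar>))"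
proof -
  have aux: "u * v \<le> B" if "\<bar>u\<bar> \<le> 1" "\<bar>v\<bar> \<le> B" for u v B :: real
  proof -
    have "\<bar>u\<bar> * \<bar>v\<bar> \<le> 1 * B" by (rule mult_mono) (use that in auto)
    then show ?thesis by (metis abs_le_D1 abs_mult mult_1)
  qed
  have nx: "next_input m i \<in> {1..m}" if "i \<in> {1..m}" for i
    using that by (intro next_input_range) auto
  show ?thesis unfolding chain_value_eq[OF assms(1)]
    by (intro sum_mono add_mono aux abs_coeff_le[OF assms(1)] p nx) auto
qed

lemma prob_dist_le_1: "prob_dist l q \<Longrightarrow> k < l \<Longrightarrow> q k \<le> 1"
  unfolding prob_dist_def using member_le_sum[of k "{..<l}" q] by auto

lemma local_behavior_abs_le_1:
  assumes "p \<in> local_behaviors d m" "a < d" "b < d" "x \<in> {1..m}" "y \<in> {1..m}"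
  shows "\<bar>p a b x y\<bar> \<le> 1"
proof -
  obtain l w PA PB where w: "prob_dist l w"
    and PA: "\<forall>x\<in>{1..m}. \<forall>k<l. prob_dist d (\<lambda>a. PA a x k)"
    and PB: "\<forall>y\<in>{1..m}. \<forall>k<l. prob_dist d (\<lambda>b. PB b y k)"
    and p: "\<forall>a<d. \<forall>b<d. \<forall>x\<in>{1..m}. \<forall>y\<in>{1..m}. p a b x y = (\<Sum>k<l. w k * PA a x k * PB b y k)"
    using assms(1) unfolding local_behaviors_def by blast
  have PA1: "0 \<le> PA a x k" "PA a x k \<le> 1" if "k < l" for k
    using PA that assms prob_dist_le_1[of d "\<lambda>a. PA a x k" a] by (auto simp: prob_dist_def)
  have PB1: "0 \<le> PB b y k" "PB b y k \<le> 1" if "k < l" for k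
    using PB that assms prob_dist_le_1[of d "\<lambda>b. PB b y k" b] by (auto simp: prob_dist_def)
  have w0: "0 \<le> w k" if "k < l" for k using w that by (auto simp: prob_dist_def)
  have "(\<Sum>k<l. w k * PA a x k * PB b y k) \<le> (\<Sum>k<l. w k * 1 * 1)"
    by (intro sum_mono mult_mono mult_nonneg_nonneg) (use PA1 PB1 w0 in auto)
  moreover have "0 \<le> (\<Sum>k<l. w k * PA a x k * PB b y k)"
    by (intro sum_nonneg mult_nonneg_nonneg) (use PA1 PB1 w0 in auto)
  ultimately show ?thesis using p assms w by (simp add: prob_dist_def)
qed

lemma deterministic_le_classical_bound:
  assumes d: "0 < d"
    and A: "\<And>x. x \<in> {1..m} \<Longrightarrow> A x < d" and B: "\<And>y. y \<in> {1..m} \<Longrightarrow> B y < d"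
  shows "(\<Sum>i=1..m. coeff_AB d \<alpha> (A i) (B i) + coeff_BA d m \<alpha> i (A (next_input m i)) (B i))
    \<le> classical_bound d m \<alpha>"
proof -
  define p :: behavior where "p a b x y = (if a = A x then 1 else 0) * (if b = B y then 1 else 0)" for a b x y
  have "p \<in> local_behaviors d m"
    unfolding local_behaviors_def mem_Collect_eq
  proof (intro exI conjI)
    show "prob_dist 1 (\<lambda>_. 1)" by (simp add: prob_dist_def)
    show "\<forall>x\<in>{1..m}. \<forall>k<1. prob_dist d (\<lambda>a. if a = A x then 1 else 0)"
      using A by (simp add: prob_dist_def)
    show "\<forall>y\<in>{1..m}. \<forall>k<1. prob_dist d (\<lambda>b. if b = B y then 1 else 0)"
      using B by (simp add: prob_dist_def)
  qed (simp add: p_def)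
  moreover have "bdd_above (chain_value d m \<alpha> ` local_behaviors d m)"
    by (rule bdd_aboveI2, rule chain_value_le[OF d], rule local_behavior_abs_le_1)
  ultimately have "chain_value d m \<alpha> p \<le> classical_bound d m \<alpha>"
    unfolding classical_bound_def by (intro cSUP_upper)
  moreover have pick: "(\<Sum>a<d. \<Sum>b<d. p a b x y * F a b) = F (A x) (B y)"
    if "x \<in> {1..m}" "y \<in> {1..m}" for x y and F :: "nat \<Rightarrow> nat \<Rightarrow> real"
  proof -
    have row: "(\<Sum>b<d. (if b = B y then 1 else 0) * G b) = G (B y)" for G :: "nat \<Rightarrow> real"
      using B[OF that(2)] by (simp add: if_distrib[of "\<lambda>z. z * _"] cong: if_cong)
    have "(\<Sum>a<d. \<Sum>b<d. p a b x y * F a b) = (\<Sum>a<d. if a = A x then F a (B y) else 0)"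
      unfolding p_def mult.assoc sum_distrib_left[symmetric] row by (intro sum.cong[OF refl]) simp
    then show ?thesis using A[OF that(1)] B[OF that(2)] by simp
  qed
  moreover have "chain_value d m \<alpha> p
      = (\<Sum>i=1..m. coeff_AB d \<alpha> (A i) (B i) + coeff_BA d m \<alpha> i (A (next_input m i)) (B i))"
    unfolding chain_value_eq[OF d]
  proof (rule sum.cong[OF refl])
    fix i assume i: "i \<in> {1..m}"
    then have "next_input m i \<in> {1..m}" by (intro next_input_range) auto
    then show "(\<Sum>a<d. \<Sum>b<d. p a b i i * coeff_AB d \<alpha> a b)
        + (\<Sum>a<d. \<Sum>b<d. p a b (next_input m i) i * coeff_BA d m \<alpha> i a b)
      = coeff_AB d \<alpha> (A i) (B i) + coeff_BA d m \<alpha> i (A (next_input m i)) (B i)"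
      by (simp only: pick[OF i i] pick[OF _ i])
  qed
  ultimately show ?thesis by simp
qed

lemma sum_lessThan_double:
  fixes g :: "nat \<Rightarrow> 'a::comm_monoid_add"
  shows "(\<Sum>t<2 * n. g t) = (\<Sum>k<n. g (2 * k) + g (Suc (2 * k)))"
  by (induction n) (simp_all add: add.assoc)

text \<open>\<open>T a x y u b\<close> plays the role of the joint probability of \<open>A_xs = a\<close>, \<open>A_x = u\<close>, \<open>B_y = b\<close>.
  For fixed \<open>a\<close>, following the cycle of inputs once around from \<open>xs\<close> gives a path whose edge weights
  \<open>T a\<close> have consistent vertex marginals. Its two end points both stand for \<open>A_xs\<close>; where they are
  both equal to \<open>a\<close> the path is a deterministic strategy, and the remaining weight is \<open>Q a xs u\<close>
  with \<open>u \<noteq> a\<close>.\<close>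

lemma chain_value_le_classical_bound_plus_defect:
  fixes T :: "nat \<Rightarrow> nat \<Rightarrow> nat \<Rightarrow> nat \<Rightarrow> nat \<Rightarrow> real"
  assumes d: "0 < d" and xs: "xs \<in> {1..m}"
    and nonneg: "\<And>a x y u b. \<lbrakk>a < d; x \<in> {1..m}; y \<in> {1..m}; u < d; b < d\<rbrakk> \<Longrightarrow> 0 \<le> T a x y u b"
    and marginal_b: "\<And>a x y u. \<lbrakk>a < d; x \<in> {1..m}; y \<in> {1..m}; u < d\<rbrakk> \<Longrightarrow> (\<Sum>b<d. T a x y u b) = Q a x u"
    and marginal_u: "\<And>a x y b. \<lbrakk>a < d; x \<in> {1..m}; y \<in> {1..m}; b < d\<rbrakk> \<Longrightarrow> (\<Sum>u<d. T a x y u b) = S a y b"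
    and marginal_a: "\<And>x y u b. \<lbrakk>x \<in> {1..m}; y \<in> {1..m}; u < d; b < d\<rbrakk> \<Longrightarrow> (\<Sum>a<d. T a x y u b) = p u b x y"
    and total: "(\<Sum>a<d. \<Sum>u<d. Q a xs u) = 1"
  shows "chain_value d m \<alpha> p \<le> classical_bound d m \<alpha>
    + 8 * real m * (\<Sum>k<d. \<bar>\<alpha> k\<bar>) * (\<Sum>a<d. \<Sum>u\<in>{..<d} - {a}. Q a xs u)"
proof -
  have m: "0 < m" using xs by simp
  define C where "C = classical_bound d m \<alpha>"
  define M where "M = 2 * real m * (\<Sum>k<d. \<bar>\<alpha> k\<bar>)"
  define inp where "inp k = (xs - 1 + k) mod m + 1" for k
  have inp: "inp k \<in> {1..m}" for k
    unfolding inp_def using m by (simp add: Suc_le_eq)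
  have inp_0: "inp 0 = xs" and inp_m: "inp m = xs"
    using xs mod_add_self2[of "xs - 1" m] by (auto simp: inp_def simp del: mod_add_self2)
  have inp_Suc: "inp (Suc k) = next_input m (inp k)" for k
    unfolding inp_def next_input_def by (simp add: mod_Suc_eq)
  have sum_inp: "(\<Sum>k<m. g (inp k)) = (\<Sum>i=1..m. g i)" for g :: "nat \<Rightarrow> real"
    unfolding inp_def sum_add_mod[OF m, of "\<lambda>k. g (k + 1)"]
    by (rule sum.reindex_bij_witness[of _ "\<lambda>i. i - 1" "\<lambda>k. k + 1"]) auto
  have inj: "inj_on inp {..<m}"
  proof (rule inj_onI)
    show "k = l" if "k \<in> {..<m}" "l \<in> {..<m}" "inp k = inp l" for k l
      using inj_onD[OF bij_betw_imp_inj_on[OF bij_betw_add_mod[OF m]], of "xs - 1" k l] that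
      unfolding inp_def by linarith
  qed
  define f where "f t u v = (if even t then coeff_AB d \<alpha> u v else coeff_BA d m \<alpha> (inp (t div 2)) v u)" for t u v
  define R where "R a t u v = (if even t then T a (inp (t div 2)) (inp (t div 2)) u v
    else T a (inp (Suc (t div 2))) (inp (t div 2)) v u)" for a t u v
  define r where "r a t u = (if even t then Q a (inp (t div 2)) u else S a (inp (t div 2)) u)" for a t u
  define dev where "dev a u = (if u = a then 0 else 2 * M)" for a u :: nat
  have abs_f: "\<bar>f t u v\<bar> \<le> (\<Sum>k<d. \<bar>\<alpha> k\<bar>)" for t u v
    using abs_coeff_le[OF d] by (simp add: f_def)
  have abs_path: "\<bar>\<Sum>t<2 * m. f t (s t) (s (Suc t))\<bar> \<le> M" for s
  proof -
    have "\<bar>\<Sum>t<2 * m. f t (s t) (s (Suc t))\<bar> \<le> (\<Sum>t<2 * m. \<Sum>k<d. \<bar>\<alpha> k\<bar>)"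
      by (rule order_trans[OF sum_abs]) (intro sum_mono abs_f)
    then show ?thesis by (simp add: M_def)
  qed
  have closed_path: "(\<Sum>t<2 * m. f t (s t) (s (Suc t))) \<le> C"
    if s: "\<And>t. t \<le> 2 * m \<Longrightarrow> s t < d" and closed: "s 0 = s (2 * m)" for s
  proof -
    define pos where "pos = the_inv_into {..<m} inp"
    have pos: "pos (inp k) = k" if "k < m" for k
      unfolding pos_def using inj that by (intro the_inv_into_f_f) auto
    have range: "inp ` {..<m} = {1..m}"
      using inp inj by (intro card_subset_eq) (auto simp: card_image)
    have pos_less: "pos x < m" if "x \<in> {1..m}" for x
      using that pos range by (metis imageE lessThan_iff)
    have A_inp: "s (2 * pos (inp k)) = s (2 * k)" if "k \<le> m" for k
      using pos[of k] pos[of 0] m that closed inp_0 inp_m by (cases "k = m") auto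
    have "(\<Sum>t<2 * m. f t (s t) (s (Suc t)))
        = (\<Sum>k<m. coeff_AB d \<alpha> (s (2 * pos (inp k))) (s (Suc (2 * pos (inp k))))
          + coeff_BA d m \<alpha> (inp k) (s (2 * pos (next_input m (inp k)))) (s (Suc (2 * pos (inp k)))))"
      unfolding sum_lessThan_double
      by (intro sum.cong refl) (simp add: f_def A_inp pos inp_Suc[symmetric])
    also have "\<dots> = (\<Sum>i=1..m. coeff_AB d \<alpha> (s (2 * pos i)) (s (Suc (2 * pos i)))
        + coeff_BA d m \<alpha> i (s (2 * pos (next_input m i))) (s (Suc (2 * pos i))))"
      by (rule sum_inp)
    also have "\<dots> \<le> C"
      unfolding C_def
    proof (rule deterministic_le_classical_bound[OF d])
      show "s (2 * pos x) < d" if "x \<in> {1..m}" for x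
        by (rule s) (use pos_less[OF that] in simp)
      show "s (Suc (2 * pos y)) < d" if "y \<in> {1..m}" for y
        by (rule s) (use pos_less[OF that] in simp)
    qed
    finally show ?thesis .
  qed
  have M0: "0 \<le> M" unfolding M_def by (intro mult_nonneg_nonneg sum_nonneg) auto
  have "- M \<le> C"
    using closed_path[of "\<lambda>_. 0"] abs_path[of "\<lambda>_. 0"] d by (simp add: abs_le_iff)
  have Q0: "0 \<le> Q a xs u" if "a < d" "u < d" for a u
    unfolding marginal_b[OF that(1) xs xs that(2), symmetric]
    by (intro sum_nonneg nonneg that xs) simp
  have "(\<Sum>t<2 * m. \<Sum>u<d. \<Sum>v<d. R a t u v * f t u v)
      \<le> (\<Sum>u<d. Q a xs u) * C + 4 * M * (\<Sum>u\<in>{..<d} - {a}. Q a xs u)" if a: "a < d" for a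
  proof -
    have "(\<Sum>t<2 * m. \<Sum>u<d. \<Sum>v<d. R a t u v * f t u v)
      \<le> (\<Sum>u<d. r a 0 u * dev a u) + (\<Sum>v<d. r a (2 * m) v * (C + dev a v))"
    proof (rule path_expectation_le[OF d])
      show "0 \<le> R a t u v" if "u < d" "v < d" for t u v
        unfolding R_def using nonneg a inp that by simp
      show "(\<Sum>v<d. R a t u v) = r a t u" if "u < d" for t u
        unfolding R_def r_def using marginal_b marginal_u a inp that by simp
      show "(\<Sum>u<d. R a t u v) = r a (Suc t) v" if "v < d" for t v
        unfolding R_def r_def using marginal_b marginal_u a inp that by simp
      show "0 \<le> r a 0 u" if "u < d" for u
        unfolding r_def using Q0 a that inp_0 by simp
      show "(\<Sum>t<2 * m. f t (s t) (s (Suc t))) \<le> dev a (s 0) + (C + dev a (s (2 * m)))"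
        if "\<And>t. t \<le> 2 * m \<Longrightarrow> s t < d" for s
      proof (cases "s 0 = a \<and> s (2 * m) = a")
        case True
        then show ?thesis using closed_path[of s, OF that] by (simp add: dev_def)
      next
        case False
        then have "2 * M \<le> dev a (s 0) + dev a (s (2 * m))" using M0 by (auto simp: dev_def)
        then show ?thesis using abs_path[of s] \<open>- M \<le> C\<close> by linarith
      qed
    qed
    also have "\<dots> = (\<Sum>u<d. Q a xs u) * C + 2 * (\<Sum>u<d. Q a xs u * dev a u)"
      by (simp add: r_def inp_0 inp_m sum.distrib distrib_left sum_distrib_right)
    also have "(\<Sum>u<d. Q a xs u * dev a u) = 2 * M * (\<Sum>u\<in>{..<d} - {a}. Q a xs u)"
      unfolding sum_distrib_left
      by (rule sum.mono_neutral_cong_right) (auto simp: dev_def)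
    finally show ?thesis by simp
  qed
  then have "(\<Sum>a<d. \<Sum>t<2 * m. \<Sum>u<d. \<Sum>v<d. R a t u v * f t u v)
      \<le> (\<Sum>a<d. (\<Sum>u<d. Q a xs u) * C + 4 * M * (\<Sum>u\<in>{..<d} - {a}. Q a xs u))"
    by (intro sum_mono) auto
  also have "\<dots> = C + 4 * M * (\<Sum>a<d. \<Sum>u\<in>{..<d} - {a}. Q a xs u)"
    using total by (simp add: sum.distrib sum_distrib_right[symmetric] sum_distrib_left[symmetric])
  also have "(\<Sum>a<d. \<Sum>t<2 * m. \<Sum>u<d. \<Sum>v<d. R a t u v * f t u v) = chain_value d m \<alpha> p"
  proof -
    have AB: "(\<Sum>a<d. \<Sum>u<d. \<Sum>v<d. R a (2 * k) u v * f (2 * k) u v)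
        = (\<Sum>u<d. \<Sum>v<d. p u v (inp k) (inp k) * coeff_AB d \<alpha> u v)" for k
    proof -
      have "(\<Sum>a<d. \<Sum>u<d. \<Sum>v<d. R a (2 * k) u v * f (2 * k) u v)
          = (\<Sum>u<d. \<Sum>v<d. \<Sum>a<d. T a (inp k) (inp k) u v * coeff_AB d \<alpha> u v)"
        unfolding R_def f_def by (simp, subst sum.swap, rule sum.cong[OF refl], rule sum.swap)
      then show ?thesis using inp marginal_a by (simp add: sum_distrib_right[symmetric])
    qed
    have BA: "(\<Sum>a<d. \<Sum>u<d. \<Sum>v<d. R a (Suc (2 * k)) u v * f (Suc (2 * k)) u v)
        = (\<Sum>u<d. \<Sum>v<d. p u v (next_input m (inp k)) (inp k) * coeff_BA d m \<alpha> (inp k) u v)" for k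
    proof -
      have "(\<Sum>a<d. \<Sum>u<d. \<Sum>v<d. R a (Suc (2 * k)) u v * f (Suc (2 * k)) u v)
          = (\<Sum>a<d. \<Sum>v<d. \<Sum>u<d. T a (inp (Suc k)) (inp k) v u * coeff_BA d m \<alpha> (inp k) v u)"
        unfolding R_def f_def by (simp, rule sum.cong[OF refl], rule sum.swap)
      also have "\<dots> = (\<Sum>v<d. \<Sum>u<d. \<Sum>a<d. T a (inp (Suc k)) (inp k) v u * coeff_BA d m \<alpha> (inp k) v u)"
        by (subst sum.swap, rule sum.cong[OF refl], rule sum.swap)
      finally show ?thesis using inp marginal_a by (simp add: sum_distrib_right[symmetric] inp_Suc[symmetric])
    qed
    have "(\<Sum>a<d. \<Sum>t<2 * m. \<Sum>u<d. \<Sum>v<d. R a t u v * f t u v)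
        = (\<Sum>t<2 * m. \<Sum>a<d. \<Sum>u<d. \<Sum>v<d. R a t u v * f t u v)"
      by (rule sum.swap)
    also have "\<dots> = (\<Sum>k<m. (\<Sum>u<d. \<Sum>v<d. p u v (inp k) (inp k) * coeff_AB d \<alpha> u v)
        + (\<Sum>u<d. \<Sum>v<d. p u v (next_input m (inp k)) (inp k) * coeff_BA d m \<alpha> (inp k) u v))"
      unfolding sum_lessThan_double AB BA ..
    also have "\<dots> = chain_value d m \<alpha> p"
      unfolding chain_value_eq[OF d] by (rule sum_inp)
    finally show ?thesis .
  qed
  finally show ?thesis unfolding C_def M_def by (simp add: mult.assoc)
qed

section \<open>Positive operators on tensor products\<close>

definition pform :: "nat \<Rightarrow> (nat \<Rightarrow> nat \<Rightarrow> complex) \<Rightarrow> (nat \<Rightarrow> complex) \<Rightarrow> complex" where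
  "pform n A x = (\<Sum>i<n. \<Sum>j<n. A i j * x j * cnj (x i))"

lemma pform_Suc:
  "pform (Suc n) A x = pform n A x + x n * (\<Sum>i<n. A i n * cnj (x i))
     + cnj (x n) * (\<Sum>j<n. A n j * x j) + A n n * x n * cnj (x n)"
  unfolding pform_def
  by (simp add: sum.distrib sum_distrib_left algebra_simps)

lemma pform_cong: "(\<And>i. i < n \<Longrightarrow> x i = y i) \<Longrightarrow> pform n A x = pform n A y"
  unfolding pform_def by (intro sum.cong) auto

lemma cnj_eq_if_real_forms:
  fixes u v c :: complex
  assumes "\<And>t. Im (t * u + cnj t * v + c * t * cnj t) = 0"
  shows "v = cnj u"
proof -
  have "Im c = 0" "Im u + Im v = 0" "Re u = Re v"
    using assms[of 1] assms[of "-1"] assms[of "\<i>"] by auto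
  then show ?thesis by (auto simp: complex_eq_iff)
qed

lemma pform_hermitian:
  assumes "\<And>x. 0 \<le> pform (Suc n) A x" and "i < n"
  shows "A n i = cnj (A i n)"
proof -
  have "Im (t * A i n + cnj t * A n i + A n n * t * cnj t) = 0" for t
  proof -
    define x :: "nat \<Rightarrow> complex" where "x k = (if k = i then 1 else if k = n then t else 0)" for k
    have 1: "(\<Sum>k<n. A k n * cnj (x k)) = A i n" "(\<Sum>k<n. A n k * x k) = A n i"
      using assms(2) by (auto simp: x_def if_distrib[of cnj] if_distrib[of "(*) _"] cong: if_cong)
    have "Im (pform (Suc n) A x) = 0" "Im (pform (Suc n) A (x(n := 0))) = 0"
      using assms(1) by (metis Im_complex_of_real complex_is_Real_iff less_eq_complex_def zero_complex.simps(2))+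
    moreover have "pform n A (x(n := 0)) = pform n A x"
      by (intro pform_cong) auto
    moreover have "x n = t" using assms(2) by (simp add: x_def)
    moreover have "(\<Sum>k<n. A k n * cnj ((x(n := 0)) k)) = A i n" "(\<Sum>k<n. A n k * (x(n := 0)) k) = A n i"
      using 1 by auto
    ultimately have "Im (pform n A x) = 0"
      "Im (pform n A x + t * A i n + cnj t * A n i + A n n * t * cnj t) = 0"
      unfolding pform_Suc 1 by auto
    then show ?thesis by simp
  qed
  then show ?thesis by (rule cnj_eq_if_real_forms)
qed

lemma rank_one_decomposition:
  assumes "\<And>x. 0 \<le> pform n A x"
  shows "\<exists>(K::nat) v. \<forall>i<n. \<forall>j<n. A i j = (\<Sum>k<K. v k i * cnj (v k j))"
  using assms
proof (induction n arbitrary: A)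
  case 0
  show ?case by simp
next
  case (Suc n)
  define c where "c = A n n"
  define L where "L x = (\<Sum>j<n. A n j * x j)" for x
  have herm: "A n i = cnj (A i n)" if "i < n" for i
    using pform_hermitian[OF Suc.prems that] .
  have cnj_L: "(\<Sum>i<n. A i n * cnj (x i)) = cnj (L x)" for x
    unfolding L_def by (simp add: herm)
  have form: "0 \<le> pform n A x + t * cnj (L x) + cnj t * L x + c * t * cnj t" for x t
  proof -
    have "pform n A (x(n := t)) = pform n A x" "L (x(n := t)) = L x"
      unfolding L_def by (auto intro: pform_cong)
    then show ?thesis
      using Suc.prems[of "x(n := t)"]
      unfolding pform_Suc cnj_L c_def L_def[of "x(n := t)", symmetric] by (simp del: fun_upd_apply add: fun_upd_same)
  qed
  have c0: "0 \<le> c" using form[of "\<lambda>_. 0" 1] by (simp add: pform_def L_def)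
  have row0: "A n j = 0" if c: "c = 0" and "j < n" for j
  proof -
    define x :: "nat \<Rightarrow> complex" where "x k = (if k = j then 1 else 0)" for k
    have Lx: "L x = A n j" using \<open>j < n\<close> by (auto simp: L_def x_def if_distrib[of "(*) _"] cong: if_cong)
    have ge: "0 \<le> Re (pform n A x) - 2 * s * (cmod (A n j))\<^sup>2" for s :: real
    proof -
      have "0 \<le> Re (pform n A x + (- of_real s * L x) * cnj (L x) + cnj (- of_real s * L x) * L x)"
        using form[of x "- of_real s * L x"] c by (auto simp: less_eq_complex_def)
      also have "\<dots> = Re (pform n A x) - 2 * s * (cmod (A n j))\<^sup>2"
        unfolding Lx cmod_power2 by (simp add: algebra_simps power2_eq_square)
      finally show ?thesis .
    qed
    have "(cmod (A n j))\<^sup>2 = 0"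
    proof (rule ccontr)
      assume "(cmod (A n j))\<^sup>2 \<noteq> 0"
      then show False
        using ge[of "(Re (pform n A x) + 1) / (2 * (cmod (A n j))\<^sup>2)"] by simp
    qed
    then show ?thesis by simp
  qed
  define A' where "A' i j = A i j - A i n * A n j / c" for i j
  have "0 \<le> pform n A' x" for x
  proof -
    have "pform n A' x = pform n A x - cnj (L x) * L x / c"
    proof -
      have "cnj (L x) * L x / c = (\<Sum>i<n. \<Sum>j<n. (A i n * A n j / c) * x j * cnj (x i))"
        unfolding cnj_L[of x, symmetric]
        by (simp only: L_def sum_product sum_divide_distrib) (simp add: mult_ac)
      then show ?thesis
        by (simp only: pform_def A'_def left_diff_distrib sum_subtractf)
    qed
    also have "\<dots> = pform n A x + t * cnj (L x) + cnj t * L x + c * t * cnj t"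
      if t: "t = - L x / c" for t
    proof -
      have "cnj c = c" using c0 by (simp add: less_eq_complex_def complex_eq_iff)
      then show ?thesis unfolding t by (cases "c = 0") (auto simp: field_simps)
    qed
    finally show ?thesis using form by metis
  qed
  then obtain K v where v: "\<forall>i<n. \<forall>j<n. A' i j = (\<Sum>k<(K::nat). v k i * cnj (v k j))"
    using Suc.IH by blast
  define s where "s = complex_of_real (sqrt (Re c))"
  have s: "s * cnj s = c"
    using c0 by (auto simp: s_def less_eq_complex_def complex_eq_iff)
  define v' where "v' k i = (if k < K then (if i < n then v k i else 0) else A i n / s)" for k i
  have "A i j = (\<Sum>k<Suc K. v' k i * cnj (v' k j))" if ij: "i < Suc n" "j < Suc n" for i j
  proof -
    have "(\<Sum>k<K. v' k i * cnj (v' k j)) = (if i < n \<and> j < n then A' i j else 0)"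
      using v by (auto simp: v'_def)
    also have "\<dots> = A i j - A i n * A n j / c"
    proof (cases "c = 0")
      case True
      then show ?thesis
        using ij row0[OF True] herm by (auto simp: A'_def c_def less_Suc_eq)
    next
      case False
      then show ?thesis using ij by (auto simp: A'_def c_def less_Suc_eq)
    qed
    finally have "(\<Sum>k<K. v' k i * cnj (v' k j)) = A i j - A i n * A n j / c" .
    moreover have "A n j = cnj (A j n)"
    proof (cases "j = n")
      case True
      then show ?thesis using c0 by (simp add: c_def less_eq_complex_def complex_eq_iff)
    qed (use ij herm in auto)
    ultimately show ?thesis by (simp add: v'_def s[symmetric])
  qed
  then show ?case by blast
qed

lemma psd_iff_pform:
  "psd n A \<longleftrightarrow> A \<in> carrier_mat n n \<and> (\<forall>x. 0 \<le> pform n (\<lambda>i j. A $$ (i, j)) x)"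
proof (cases "A \<in> carrier_mat n n")
  case A: True
  have "(A *\<^sub>v v) \<bullet>c v = pform n (\<lambda>i j. A $$ (i, j)) (($) v)" if "v \<in> carrier_vec n" for v
    using A that unfolding pform_def scalar_prod_def
    by (auto simp: scalar_prod_def sum_distrib_right atLeast0LessThan intro!: sum.cong)
  moreover have "pform n (\<lambda>i j. A $$ (i, j)) x = pform n (\<lambda>i j. A $$ (i, j)) (($) (vec n x))" for x
    by (rule pform_cong) simp
  ultimately show ?thesis unfolding psd_def using A
    by (metis vec_carrier)
qed (simp add: psd_def)

lemma psd_mat_sum:
  assumes "finite I" and "\<And>k. k \<in> I \<Longrightarrow> psd n (E k)"
  shows "psd n (mat_sum n E I)"
proof -
  have "pform n (\<lambda>i j. mat_sum n E I $$ (i, j)) x = (\<Sum>k\<in>I. pform n (\<lambda>i j. E k $$ (i, j)) x)" for x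
    unfolding pform_def mat_sum_def
    by (simp add: sum_distrib_right sum.swap[of _ I])
  then show ?thesis using assms by (auto simp: psd_iff_pform mat_sum_def intro!: sum_nonneg)
qed

lemma psd_smult:
  assumes "psd n A" and "0 \<le> c"
  shows "psd n (complex_of_real c \<cdot>\<^sub>m A)"
proof -
  have "pform n (\<lambda>i j. (complex_of_real c \<cdot>\<^sub>m A) $$ (i, j)) x
      = complex_of_real c * pform n (\<lambda>i j. A $$ (i, j)) x" for x
    using assms(1) unfolding pform_def psd_def
    by (auto simp: sum_distrib_left algebra_simps intro!: sum.cong)
  then show ?thesis using assms by (auto simp: psd_iff_pform less_eq_complex_def)
qed

lemma psd_zero: "psd n (0\<^sub>m n n)"
  by (auto simp: psd_iff_pform pform_def)

lemma psd_one: "psd n (1\<^sub>m n)"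
proof -
  have "pform n (\<lambda>i j. 1\<^sub>m n $$ (i, j)) x = (\<Sum>i<n. x i * cnj (x i))" for x :: "nat \<Rightarrow> complex"
    unfolding pform_def
  proof (intro sum.cong refl)
    fix i assume "i \<in> {..<n}"
    then have "(\<Sum>j<n. 1\<^sub>m n $$ (i, j) * x j * cnj (x i)) = (\<Sum>j<n. if j = i then x j * cnj (x i) else 0)"
      by (intro sum.cong) auto
    then show "(\<Sum>j<n. 1\<^sub>m n $$ (i, j) * x j * cnj (x i)) = x i * cnj (x i)"
      using \<open>i \<in> {..<n}\<close> by simp
  qed
  then show ?thesis by (auto simp: psd_iff_pform less_eq_complex_def intro!: sum_nonneg)
qed

lemma sum_product_index:
  fixes f :: "nat \<Rightarrow> 'a::comm_monoid_add"
  shows "(\<Sum>p<nA * nB. f p) = (\<Sum>i<nA. \<Sum>j<nB. f (i * nB + j))"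
proof -
  have "(\<Sum>p<nA * nB. f p) = (\<Sum>i<nA. sum f {i * nB..<i * nB + nB})"
    by (simp add: sum.nat_group)
  also have "\<dots> = (\<Sum>i<nA. \<Sum>j<nB. f (i * nB + j))"
  proof (rule sum.cong[OF refl])
    show "sum f {i * nB..<i * nB + nB} = (\<Sum>j<nB. f (i * nB + j))" for i
      using sum.shift_bounds_nat_ivl[of f 0 "i * nB" nB] by (simp add: add.commute atLeast0LessThan)
  qed
  finally show ?thesis .
qed

lemma tensor_trace_index:
  assumes "E \<in> carrier_mat nA nA" "F \<in> carrier_mat nB nB" "\<rho> \<in> carrier_mat (nA * nB) (nA * nB)"
  shows "mat_trace (tensor_mat E F * \<rho>) =
    (\<Sum>i<nA. \<Sum>j<nB. \<Sum>i'<nA. \<Sum>j'<nB.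
       E $$ (i, i') * F $$ (j, j') * \<rho> $$ (i' * nB + j', i * nB + j))"
proof -
  have idx: "i * nB + j < nA * nB" if "i < nA" "j < nB" for i j
    proof -
    have "i * nB + j < Suc i * nB" using that by simp
    also have "\<dots> \<le> nA * nB" using that by (intro mult_right_mono) auto
    finally show ?thesis .
  qed
  have T: "tensor_mat E F \<in> carrier_mat (nA * nB) (nA * nB)"
    using assms by (auto simp: tensor_mat_def)
  have "mat_trace (tensor_mat E F * \<rho>)
      = (\<Sum>p<nA * nB. \<Sum>q<nA * nB. tensor_mat E F $$ (p, q) * \<rho> $$ (q, p))"
    unfolding mat_trace_def using T assms(3)
    by (auto simp: scalar_prod_def atLeast0LessThan intro!: sum.cong)
  also have "\<dots> = (\<Sum>i<nA. \<Sum>j<nB. \<Sum>i'<nA. \<Sum>j'<nB.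
       E $$ (i, i') * F $$ (j, j') * \<rho> $$ (i' * nB + j', i * nB + j))"
    unfolding sum_product_index using assms idx
    by (intro sum.cong refl) (auto simp: tensor_mat_def)
  finally show ?thesis .
qed

lemma tensor_trace_sum_left:
  assumes "finite I" "\<And>k. k \<in> I \<Longrightarrow> E k \<in> carrier_mat nA nA" "F \<in> carrier_mat nB nB"
    "\<rho> \<in> carrier_mat (nA * nB) (nA * nB)"
  shows "mat_trace (tensor_mat (mat_sum nA E I) F * \<rho>) = (\<Sum>k\<in>I. mat_trace (tensor_mat (E k) F * \<rho>))"
proof -
  have "mat_sum nA E I \<in> carrier_mat nA nA" by (simp add: mat_sum_def)
  moreover have "(\<Sum>k\<in>I. mat_trace (tensor_mat (E k) F * \<rho>)) = (\<Sum>k\<in>I.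
      \<Sum>i<nA. \<Sum>j<nB. \<Sum>i'<nA. \<Sum>j'<nB. E k $$ (i, i') * F $$ (j, j') * \<rho> $$ (i' * nB + j', i * nB + j))"
    using assms by (intro sum.cong[OF refl] tensor_trace_index) auto
  ultimately show ?thesis
    using assms(3,4) by (simp add: tensor_trace_index)
      (simp add: mat_sum_def sum_distrib_left sum_distrib_right sum.swap[of _ I])
qed

lemma tensor_trace_sum_right:
  assumes "finite I" "\<And>k. k \<in> I \<Longrightarrow> F k \<in> carrier_mat nB nB" "E \<in> carrier_mat nA nA"
    "\<rho> \<in> carrier_mat (nA * nB) (nA * nB)"
  shows "mat_trace (tensor_mat E (mat_sum nB F I) * \<rho>) = (\<Sum>k\<in>I. mat_trace (tensor_mat E (F k) * \<rho>))"
proof -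
  have "mat_sum nB F I \<in> carrier_mat nB nB" by (simp add: mat_sum_def)
  moreover have "(\<Sum>k\<in>I. mat_trace (tensor_mat E (F k) * \<rho>)) = (\<Sum>k\<in>I.
      \<Sum>i<nA. \<Sum>j<nB. \<Sum>i'<nA. \<Sum>j'<nB. E $$ (i, i') * F k $$ (j, j') * \<rho> $$ (i' * nB + j', i * nB + j))"
    using assms by (intro sum.cong[OF refl] tensor_trace_index) auto
  ultimately show ?thesis
    using assms(3,4) by (simp add: tensor_trace_index)
      (simp add: mat_sum_def sum_distrib_left sum_distrib_right sum.swap[of _ I])
qed

lemma tensor_one: "tensor_mat (1\<^sub>m nA) (1\<^sub>m nB) = 1\<^sub>m (nA * nB)"
proof (rule eq_matI)
  fix i j assume ij: "i < dim_row (1\<^sub>m (nA * nB))" "j < dim_col (1\<^sub>m (nA * nB))"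
  then have B: "nB > 0" by (cases nB) auto
  have "i div nB < nA" "j div nB < nA"
    using ij by (auto simp: less_mult_imp_div_less)
  moreover have "i = j \<longleftrightarrow> i div nB = j div nB \<and> i mod nB = j mod nB"
    by (metis div_mult_mod_eq)
  ultimately show "tensor_mat (1\<^sub>m nA) (1\<^sub>m nB) $$ (i, j) = 1\<^sub>m (nA * nB) $$ (i, j)"
    using ij B by (auto simp: tensor_mat_def)
qed (auto simp: tensor_mat_def)

lemma tensor_trace_nonneg:
  assumes "psd nA E" "psd nB F" "psd (nA * nB) \<rho>"
  shows "0 \<le> mat_trace (tensor_mat E F * \<rho>)"
proof -
  obtain K v where v: "\<forall>i<nA. \<forall>j<nA. E $$ (i, j) = (\<Sum>k<(K::nat). v k i * cnj (v k j))"
    using rank_one_decomposition[of nA "\<lambda>i j. E $$ (i, j)"] assms(1) by (auto simp: psd_iff_pform)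
  obtain L w where w: "\<forall>i<nB. \<forall>j<nB. F $$ (i, j) = (\<Sum>k<(L::nat). w k i * cnj (w k j))"
    using rank_one_decomposition[of nB "\<lambda>i j. F $$ (i, j)"] assms(2) by (auto simp: psd_iff_pform)
  define x where "x k l p = v k (p div nB) * w l (p mod nB)" for k l p
  define h where "h z p q = \<rho> $$ (fst p * nB + snd p, fst q * nB + snd q)
    * x (fst z) (snd z) (fst q * nB + snd q) * cnj (x (fst z) (snd z) (fst p * nB + snd p))" for z p q
  let ?KL = "{..<K} \<times> {..<L}" and ?I = "{..<nA} \<times> {..<nB}"
  have "0 \<le> pform (nA * nB) (\<lambda>i j. \<rho> $$ (i, j)) (x k l)" for k l
    using assms(3) by (auto simp: psd_iff_pform)
  then have "0 \<le> (\<Sum>k<K. \<Sum>l<L. pform (nA * nB) (\<lambda>i j. \<rho> $$ (i, j)) (x k l))"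
    by (intro sum_nonneg) auto
  also have "\<dots> = (\<Sum>z\<in>?KL. \<Sum>p\<in>?I. \<Sum>q\<in>?I. h z p q)"
    unfolding pform_def sum_product_index x_def h_def
    by (simp add: sum.cartesian_product')
  also have "\<dots> = (\<Sum>z\<in>?KL. \<Sum>q\<in>?I. \<Sum>p\<in>?I. h z p q)"
    by (intro sum.cong refl sum.swap)
  also have "\<dots> = (\<Sum>q\<in>?I. \<Sum>z\<in>?KL. \<Sum>p\<in>?I. h z p q)"
    by (rule sum.swap)
  also have "\<dots> = (\<Sum>q\<in>?I. \<Sum>p\<in>?I. \<Sum>z\<in>?KL. h z p q)"
    by (intro sum.cong refl sum.swap)
  also have "\<dots> = mat_trace (tensor_mat E F * \<rho>)"
  proof -
    have "(\<Sum>z\<in>?KL. h z (i, j) (i', j')) = E $$ (i', i) * F $$ (j', j) * \<rho> $$ (i * nB + j, i' * nB + j')"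
      if "i < nA" "i' < nA" "j < nB" "j' < nB" for i j i' j'
    proof -
      have "(\<Sum>z\<in>?KL. h z (i, j) (i', j'))
          = (\<Sum>k<K. \<Sum>l<L. (v k i' * cnj (v k i)) * (w l j' * cnj (w l j))) * \<rho> $$ (i * nB + j, i' * nB + j')"
        using that
          by (simp add: h_def x_def sum.cartesian_product' sum_distrib_right sum_distrib_left mult_ac add.commute)
      then show ?thesis using v w that by (simp add: sum_product)
    qed
    then have "(\<Sum>q\<in>?I. \<Sum>p\<in>?I. \<Sum>z\<in>?KL. h z p q)
      = (\<Sum>(i', j')\<in>?I. \<Sum>(i, j)\<in>?I. E $$ (i', i) * F $$ (j', j) * \<rho> $$ (i * nB + j, i' * nB + j'))"
      by (auto intro!: sum.cong)
    then show ?thesis using assms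
      by (subst tensor_trace_index[of _ nA _ nB]) (auto simp: psd_def sum.cartesian_product')
  qed
  finally show ?thesis .
qed

section \<open>Quantum behaviors\<close>

definition bipartite_prob :: "complex mat \<Rightarrow> complex mat \<Rightarrow> complex mat \<Rightarrow> real" where
  "bipartite_prob \<rho> E F = Re (mat_trace (tensor_mat E F * \<rho>))"

lemma psd_carrier: "psd n A \<Longrightarrow> A \<in> carrier_mat n n"
  by (simp add: psd_def)

lemma bipartite_prob_sum_left:
  assumes "finite I" "\<And>k. k \<in> I \<Longrightarrow> psd nA (E k)" "psd nB F" "psd (nA * nB) \<rho>"
  shows "bipartite_prob \<rho> (mat_sum nA E I) F = (\<Sum>k\<in>I. bipartite_prob \<rho> (E k) F)"
  unfolding bipartite_prob_def using assms
  by (subst tensor_trace_sum_left[of _ _ nA _ nB]) (auto simp: psd_carrier)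

lemma bipartite_prob_sum_right:
  assumes "finite I" "\<And>k. k \<in> I \<Longrightarrow> psd nB (F k)" "psd nA E" "psd (nA * nB) \<rho>"
  shows "bipartite_prob \<rho> E (mat_sum nB F I) = (\<Sum>k\<in>I. bipartite_prob \<rho> E (F k))"
  unfolding bipartite_prob_def using assms
  by (subst tensor_trace_sum_right[of _ _ nB _ nA]) (auto simp: psd_carrier)

lemma bipartite_prob_zero_left:
  assumes "psd nB F" "psd (nA * nB) \<rho>"
  shows "bipartite_prob \<rho> (0\<^sub>m nA nA) F = 0"
proof -
  have "mat_sum nA E {} = 0\<^sub>m nA nA" for E :: "nat \<Rightarrow> complex mat"
    by (auto simp: mat_sum_def)
  then show ?thesis using bipartite_prob_sum_left[of "{} :: nat set" nA _ nB F \<rho>] assms by simp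
qed

lemma bipartite_prob_nonneg:
  assumes "psd nA E" "psd nB F" "psd (nA * nB) \<rho>"
  shows "0 \<le> bipartite_prob \<rho> E F"
  using tensor_trace_nonneg[OF assms] by (simp add: bipartite_prob_def less_eq_complex_def)

lemma bipartite_prob_one:
  assumes "density_operator (nA * nB) \<rho>"
  shows "bipartite_prob \<rho> (1\<^sub>m nA) (1\<^sub>m nB) = 1"
  using assms left_mult_one_mat[of \<rho> "nA * nB" "nA * nB"]
  by (simp add: bipartite_prob_def tensor_one density_operator_def psd_def)

lemma quantum_realizationD:
  assumes "quantum_realization d m nA nB MA MB \<rho> p"
  shows "\<And>x a. x \<in> {1..m} \<Longrightarrow> a < d \<Longrightarrow> psd nA (MA x a)"
    and "\<And>y b. y \<in> {1..m} \<Longrightarrow> b < d \<Longrightarrow> psd nB (MB y b)"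
    and "\<And>x. x \<in> {1..m} \<Longrightarrow> mat_sum nA (MA x) {..<d} = 1\<^sub>m nA"
    and "\<And>y. y \<in> {1..m} \<Longrightarrow> mat_sum nB (MB y) {..<d} = 1\<^sub>m nB"
    and "density_operator (nA * nB) \<rho>" and "psd (nA * nB) \<rho>"
    and "\<And>a b x y. \<lbrakk>a < d; b < d; x \<in> {1..m}; y \<in> {1..m}\<rbrakk> \<Longrightarrow> p a b x y = bipartite_prob \<rho> (MA x a) (MB y b)"
proof -
  fix a b x y assume "a < d" "b < d" "x \<in> {1..m}" "y \<in> {1..m}"
  then have "complex_of_real (p a b x y) = mat_trace (tensor_mat (MA x a) (MB y b) * \<rho>)"
    using assms unfolding quantum_realization_def by blast
  then show "p a b x y = bipartite_prob \<rho> (MA x a) (MB y b)"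
    unfolding bipartite_prob_def by (metis Re_complex_of_real)
qed (use assms in \<open>auto simp: quantum_realization_def povm_def density_operator_def\<close>)

lemma compatible_pair_joint:
  assumes "compatible d n M {c, x}"
  shows "\<exists>J. (\<forall>a<d. \<forall>u<d. psd n (J a u))
    \<and> (\<forall>u<d. M x u = mat_sum n (\<lambda>a. J a u) {..<d})
    \<and> (\<forall>a<d. M c a = mat_sum n (J a) {..<d})"
proof -
  obtain l G q where G: "povm n l G"
    and q: "\<forall>z\<in>{c, x}. \<forall>k<l. prob_dist d (\<lambda>a. q a z k)"
    and M: "\<forall>z\<in>{c, x}. \<forall>a<d. M z a = mat_sum n (\<lambda>k. complex_of_real (q a z k) \<cdot>\<^sub>m G k) {..<l}"
    using assms unfolding compatible_def by blast
  have G_psd: "psd n (G k)" if "k < l" for k using G that by (simp add: povm_def)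
  have G_dim: "dim_row (G k) = n" "dim_col (G k) = n" if "k < l" for k
    using psd_carrier[OF G_psd[OF that]] by auto
  have q_sum: "(\<Sum>a<d. complex_of_real (q a z k)) = 1" if "z \<in> {c, x}" "k < l" for z k
    using q that unfolding prob_dist_def by (metis of_real_1 of_real_sum)
  define J where "J a u = mat_sum n (\<lambda>k. complex_of_real (q a c k * q u x k) \<cdot>\<^sub>m G k) {..<l}" for a u
  have "psd n (J a u)" if "a < d" "u < d" for a u
    unfolding J_def using q that G_psd
    by (intro psd_mat_sum psd_smult mult_nonneg_nonneg) (auto simp: prob_dist_def)
  moreover have "M x u = mat_sum n (\<lambda>a. J a u) {..<d}" if "u < d" for u
  proof (rule eq_matI)
    fix i j assume "i < dim_row (mat_sum n (\<lambda>a. J a u) {..<d})" "j < dim_col (mat_sum n (\<lambda>a. J a u) {..<d})"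
    then have ij: "i < n" "j < n" by (simp_all add: mat_sum_def)
    have "mat_sum n (\<lambda>a. J a u) {..<d} $$ (i, j)
        = (\<Sum>k<l. \<Sum>a<d. complex_of_real (q a c k) * (complex_of_real (q u x k) * G k $$ (i, j)))"
      using ij G_dim by (simp add: mat_sum_def J_def mult.assoc) (rule sum.swap)
    then show "M x u $$ (i, j) = mat_sum n (\<lambda>a. J a u) {..<d} $$ (i, j)"
      using ij G_dim M that q_sum by (simp add: mat_sum_def sum_distrib_right[symmetric])
  qed (use M that in \<open>auto simp: mat_sum_def\<close>)
  moreover have "M c a = mat_sum n (J a) {..<d}" if "a < d" for a
  proof (rule eq_matI)
    fix i j assume "i < dim_row (mat_sum n (J a) {..<d})" "j < dim_col (mat_sum n (J a) {..<d})"
    then have ij: "i < n" "j < n" by (simp_all add: mat_sum_def)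
    have "mat_sum n (J a) {..<d} $$ (i, j)
        = (\<Sum>k<l. \<Sum>u<d. complex_of_real (q u x k) * (complex_of_real (q a c k) * G k $$ (i, j)))"
      using ij G_dim by (simp add: mat_sum_def J_def mult_ac) (rule sum.swap)
    then show "M c a $$ (i, j) = mat_sum n (J a) {..<d} $$ (i, j)"
      using ij G_dim M that q_sum by (simp add: mat_sum_def sum_distrib_right[symmetric])
  qed (use M that in \<open>auto simp: mat_sum_def\<close>)
  ultimately show ?thesis by blast
qed

lemma self_joint:
  fixes E :: "nat \<Rightarrow> complex mat"
  assumes "\<And>a. a < d \<Longrightarrow> psd n (E a)" and "a < d"
  shows "E a = mat_sum n (\<lambda>u. if a = u then E u else 0\<^sub>m n n) {..<d}"
proof -
  have "(\<Sum>u<d. (if a = u then E u else 0\<^sub>m n n) $$ (i, j)) = E a $$ (i, j)" if "i < n" "j < n" for i j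
  proof -
    have "(\<Sum>u<d. (if a = u then E u else 0\<^sub>m n n) $$ (i, j)) = (\<Sum>u<d. if a = u then E u $$ (i, j) else 0)"
      using that by (intro sum.cong) auto
    then show ?thesis using assms(2) by simp
  qed
  then show ?thesis
    using psd_carrier[OF assms(1)[OF assms(2)]] by (intro eq_matI) (auto simp: mat_sum_def)
qed

lemma star_compatible_chain_value_le:
  assumes d: "0 < d" and xs: "xs \<in> {1..m}"
    and real: "quantum_realization d m nA nB MA MB \<rho> p"
    and star: "star_graph m xs \<subseteq> compatibility_structure d m nA MA"
  shows "chain_value d m \<alpha> p \<le> classical_bound d m \<alpha>"
proof -
  note D = quantum_realizationD[OF real]
  define joint where "joint x J \<longleftrightarrow> (\<forall>a<d. \<forall>u<d. psd nA (J a u))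
      \<and> (\<forall>u<d. MA x u = mat_sum nA (\<lambda>a. J a u) {..<d})
      \<and> (\<forall>a<d. MA xs a = mat_sum nA (J a) {..<d})
      \<and> (x = xs \<longrightarrow> (\<forall>a u. a \<noteq> u \<longrightarrow> J a u = 0\<^sub>m nA nA))" for x and J :: "nat \<Rightarrow> nat \<Rightarrow> complex mat"
  have "\<exists>J. joint x J" if x: "x \<in> {1..m}" for x
  proof (cases "x = xs")
    case True
    have E: "MA xs a = mat_sum nA (\<lambda>u. if a = u then MA xs u else 0\<^sub>m nA nA) {..<d}" if "a < d" for a
      using D(1)[OF xs] that by (rule self_joint)
    have flip: "(\<lambda>a. if a = u then MA xs u else 0\<^sub>m nA nA) = (\<lambda>a. if u = a then MA xs a else 0\<^sub>m nA nA)" for u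
      by auto
    have "joint x (\<lambda>a u. if a = u then MA xs u else 0\<^sub>m nA nA)"
      unfolding joint_def flip using True E D(1)[OF xs] psd_zero by simp
    then show ?thesis by blast
  next
    case False
    then have "{xs, x} \<in> compatibility_structure d m nA MA" using star x by (auto simp: star_graph_def)
    then have "compatible d nA MA {xs, x}" by (simp add: compatibility_structure_def)
    from compatible_pair_joint[OF this] show ?thesis using False by (simp add: joint_def)
  qed
  then have "\<forall>x\<in>{1..m}. \<exists>J. joint x J" by blast
  then obtain J where joint: "\<And>x. x \<in> {1..m} \<Longrightarrow> joint x (J x)" by (metis bchoice)
  have J: "psd nA (J x a u)" if "x \<in> {1..m}" "a < d" "u < d" for x a u
    using joint[OF that(1)] that by (simp add: joint_def)
  have J_right: "mat_sum nA (\<lambda>a. J x a u) {..<d} = MA x u" if "x \<in> {1..m}" "u < d" for x u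
    using joint[OF that(1)] that by (simp add: joint_def)
  have J_left: "mat_sum nA (J x a) {..<d} = MA xs a" if "x \<in> {1..m}" "a < d" for x a
    using joint[OF that(1)] that by (simp add: joint_def)
  have J_xs: "J xs a u = 0\<^sub>m nA nA" if "a \<noteq> u" for a u
    using joint[OF xs] that by (simp add: joint_def)
  have left: "(\<Sum>u<d. bipartite_prob \<rho> (J x a u) F) = bipartite_prob \<rho> (MA xs a) F"
    if "x \<in> {1..m}" "a < d" "psd nB F" for x a F
    using bipartite_prob_sum_left[of "{..<d}" nA "J x a" nB F \<rho>] J J_left D(6) that by simp
  define Q where "Q a x u = bipartite_prob \<rho> (J x a u) (1\<^sub>m nB)" for a x u
  have "chain_value d m \<alpha> p \<le> classical_bound d m \<alpha>
    + 8 * real m * (\<Sum>k<d. \<bar>\<alpha> k\<bar>) * (\<Sum>a<d. \<Sum>u\<in>{..<d} - {a}. Q a xs u)"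
  proof (rule chain_value_le_classical_bound_plus_defect[OF d xs, where Q = Q
        and T = "\<lambda>a x y u b. bipartite_prob \<rho> (J x a u) (MB y b)"
        and S = "\<lambda>a y b. bipartite_prob \<rho> (MA xs a) (MB y b)"])
    fix a x y u b assume ax: "a < d" "x \<in> {1..m}" "y \<in> {1..m}"
    show "0 \<le> bipartite_prob \<rho> (J x a u) (MB y b)" if "u < d" "b < d"
      using ax that by (intro bipartite_prob_nonneg[OF J D(2) D(6)])
    show "(\<Sum>b<d. bipartite_prob \<rho> (J x a u) (MB y b)) = Q a x u" if "u < d"
      unfolding Q_def
      using bipartite_prob_sum_right[of "{..<d}" nB "MB y" nA "J x a u" \<rho>] ax that J D(2,4,6) by simp
    show "(\<Sum>u<d. bipartite_prob \<rho> (J x a u) (MB y b)) = bipartite_prob \<rho> (MA xs a) (MB y b)" if "b < d"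
      using left ax that D(2) by simp
  next
    fix x y u b assume "x \<in> {1..m}" "y \<in> {1..m}" "u < d" "b < d"
    then show "(\<Sum>a<d. bipartite_prob \<rho> (J x a u) (MB y b)) = p u b x y"
      using bipartite_prob_sum_left[of "{..<d}" nA "\<lambda>a. J x a u" nB "MB y b" \<rho>] J J_right D(2,6,7) by simp
  next
    show "(\<Sum>a<d. \<Sum>u<d. Q a xs u) = 1"
      unfolding Q_def
      using bipartite_prob_sum_left[of "{..<d}" nA "MA xs" nB "1\<^sub>m nB" \<rho>] bipartite_prob_one[OF D(5)]
        left xs D(1,3,6) psd_one by simp
  qed
  moreover have "(\<Sum>a<d. \<Sum>u\<in>{..<d} - {a}. Q a xs u) = 0"
    using bipartite_prob_zero_left[OF psd_one D(6)] by (simp add: Q_def J_xs)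
  ultimately show ?thesis by simp
qed

lemma quantum_behaviorD:
  assumes "p \<in> quantum_behaviors d m"
  shows "\<And>a b x y. \<lbrakk>a < d; b < d; x \<in> {1..m}; y \<in> {1..m}\<rbrakk> \<Longrightarrow> 0 \<le> p a b x y"
    and "\<And>a x y y'. \<lbrakk>a < d; x \<in> {1..m}; y \<in> {1..m}; y' \<in> {1..m}\<rbrakk> \<Longrightarrow> (\<Sum>b<d. p a b x y) = (\<Sum>b<d. p a b x y')"
    and "\<And>b x x' y. \<lbrakk>b < d; x \<in> {1..m}; x' \<in> {1..m}; y \<in> {1..m}\<rbrakk> \<Longrightarrow> (\<Sum>a<d. p a b x y) = (\<Sum>a<d. p a b x' y)"
    and "\<And>x y. \<lbrakk>x \<in> {1..m}; y \<in> {1..m}\<rbrakk> \<Longrightarrow> (\<Sum>a<d. \<Sum>b<d. p a b x y) = 1"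
proof -
  obtain nA nB MA MB \<rho> where real: "quantum_realization d m nA nB MA MB \<rho> p"
    using assms unfolding quantum_behaviors_def by blast
  note D = quantum_realizationD[OF real]
  have A: "(\<Sum>b<d. p a b x y) = bipartite_prob \<rho> (MA x a) (1\<^sub>m nB)"
    if "a < d" "x \<in> {1..m}" "y \<in> {1..m}" for a x y
    using bipartite_prob_sum_right[of "{..<d}" nB "MB y" nA "MA x a" \<rho>] that D(1,2,4,6,7) by simp
  have B: "(\<Sum>a<d. p a b x y) = bipartite_prob \<rho> (1\<^sub>m nA) (MB y b)"
    if "b < d" "x \<in> {1..m}" "y \<in> {1..m}" for b x y
    using bipartite_prob_sum_left[of "{..<d}" nA "MA x" nB "MB y b" \<rho>] that D(1,2,3,6,7) by simp
  show "0 \<le> p a b x y" if "a < d" "b < d" "x \<in> {1..m}" "y \<in> {1..m}" for a b x y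
    using bipartite_prob_nonneg[of nA "MA x a" nB "MB y b" \<rho>] that D(1,2,6,7) by simp
  show "(\<Sum>b<d. p a b x y) = (\<Sum>b<d. p a b x y')" if "a < d" "x \<in> {1..m}" "y \<in> {1..m}" "y' \<in> {1..m}" for a x y y'
    using A[OF that(1,2,3)] A[OF that(1,2,4)] by simp
  show "(\<Sum>a<d. p a b x y) = (\<Sum>a<d. p a b x' y)" if "b < d" "x \<in> {1..m}" "x' \<in> {1..m}" "y \<in> {1..m}" for b x x' y
    using B[OF that(1,2,4)] B[OF that(1,3,4)] by simp
  show "(\<Sum>a<d. \<Sum>b<d. p a b x y) = 1" if "x \<in> {1..m}" "y \<in> {1..m}" for x y
    using bipartite_prob_sum_left[of "{..<d}" nA "MA x" nB "1\<^sub>m nB" \<rho>] bipartite_prob_one[OF D(5)]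
      that D(1,3,6) psd_one A by simp
qed

lemma guessing_familyD:
  assumes "P \<in> guessing_families d m p_obs" and "e < d" and "e' < d"
  shows "\<And>a b x y. \<lbrakk>a < d; b < d; x \<in> {1..m}; y \<in> {1..m}\<rbrakk> \<Longrightarrow> 0 \<le> P e e' a b x y"
    and "\<And>a x y y'. \<lbrakk>a < d; x \<in> {1..m}; y \<in> {1..m}; y' \<in> {1..m}\<rbrakk>
      \<Longrightarrow> (\<Sum>b<d. P e e' a b x y) = (\<Sum>b<d. P e e' a b x y')"
    and "\<And>b x x' y. \<lbrakk>b < d; x \<in> {1..m}; x' \<in> {1..m}; y \<in> {1..m}\<rbrakk>
      \<Longrightarrow> (\<Sum>a<d. P e e' a b x y) = (\<Sum>a<d. P e e' a b x' y)"
proof -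
  obtain c q where c: "0 \<le> c" and q: "q \<in> quantum_behaviors d m"
    and "\<forall>a<d. \<forall>b<d. \<forall>x\<in>{1..m}. \<forall>y\<in>{1..m}. P e e' a b x y = c * q a b x y"
  proof -
    have "\<exists>c\<ge>0. \<exists>q\<in>quantum_behaviors d m.
        \<forall>a<d. \<forall>b<d. \<forall>x\<in>{1..m}. \<forall>y\<in>{1..m}. P e e' a b x y = c * q a b x y"
      using assms by (simp add: guessing_families_def)
    then show ?thesis by (elim exE conjE bexE) (rule that)
  qed
  then have P: "P e e' a b x y = c * q a b x y"
    if "a < d" "b < d" "x \<in> {1..m}" "y \<in> {1..m}" for a b x y
    using that by simp
  note D = quantum_behaviorD[OF q]
  show "0 \<le> P e e' a b x y" if "a < d" "b < d" "x \<in> {1..m}" "y \<in> {1..m}" for a b x y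
    unfolding P[OF that] by (intro mult_nonneg_nonneg c D(1) that)
  show "(\<Sum>b<d. P e e' a b x y) = (\<Sum>b<d. P e e' a b x y')" if "a < d" "x \<in> {1..m}" "y \<in> {1..m}" "y' \<in> {1..m}" for a x y y'
    using D(2)[OF that] that by (simp add: P sum_distrib_left[symmetric])
  show "(\<Sum>a<d. P e e' a b x y) = (\<Sum>a<d. P e e' a b x' y)" if "b < d" "x \<in> {1..m}" "x' \<in> {1..m}" "y \<in> {1..m}" for b x x' y
    using D(3)[OF that] that by (simp add: P sum_distrib_left[symmetric])
qed

lemma chain_value_le_guessing:
  assumes d: "0 < d" and xs: "xs \<in> {1..m}" and ys: "ys \<in> {1..m}"
    and p_obs: "p_obs \<in> quantum_behaviors d m"
    and P: "P \<in> guessing_families d m p_obs"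
  shows "chain_value d m \<alpha> p_obs \<le> classical_bound d m \<alpha>
    + 8 * real m * (\<Sum>k<d. \<bar>\<alpha> k\<bar>) * (1 - guessing_score d xs ys P)"
proof -
  note D = guessing_familyD[OF P]
  have P_sum: "(\<Sum>e<d. \<Sum>e'<d. P e e' a b x y) = p_obs a b x y"
    if "a < d" "b < d" "x \<in> {1..m}" "y \<in> {1..m}" for a b x y
    using P that by (simp add: guessing_families_def)
  define T where "T e x y a b = (\<Sum>e'<d. P e e' a b x y)" for e x y a b
  define Q where "Q e x a = (\<Sum>b<d. T e x ys a b)" for e x a
  define S where "S e y b = (\<Sum>a<d. T e xs y a b)" for e y b
  have total: "(\<Sum>e<d. \<Sum>a<d. Q e xs a) = 1"
  proof -
    have "(\<Sum>e<d. \<Sum>a<d. Q e xs a) = (\<Sum>a<d. \<Sum>b<d. \<Sum>e<d. T e xs ys a b)"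
      unfolding Q_def by (subst sum.swap, rule sum.cong[OF refl], rule sum.swap)
    also have "\<dots> = (\<Sum>a<d. \<Sum>b<d. p_obs a b xs ys)"
      unfolding T_def using P_sum xs ys by simp
    finally show ?thesis using quantum_behaviorD(4)[OF p_obs xs ys] by simp
  qed
  have "chain_value d m \<alpha> p_obs \<le> classical_bound d m \<alpha>
    + 8 * real m * (\<Sum>k<d. \<bar>\<alpha> k\<bar>) * (\<Sum>e<d. \<Sum>a\<in>{..<d} - {e}. Q e xs a)"
  proof (rule chain_value_le_classical_bound_plus_defect[OF d xs, where Q = Q and T = T and S = S])
    fix e x y a b assume ex: "e < d" "x \<in> {1..m}" "y \<in> {1..m}"
    show "0 \<le> T e x y a b" if "a < d" "b < d"
      unfolding T_def by (intro sum_nonneg D(1) ex that) simp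
    show "(\<Sum>b<d. T e x y a b) = Q e x a" if "a < d"
      unfolding T_def Q_def
      by (subst (1 2) sum.swap, rule sum.cong[OF refl], rule D(2)) (use ex ys that in auto)
    show "(\<Sum>a<d. T e x y a b) = S e y b" if "b < d"
      unfolding T_def S_def
      by (subst (1 2) sum.swap, rule sum.cong[OF refl], rule D(3)) (use ex xs that in auto)
  next
    fix x y a b assume "x \<in> {1..m}" "y \<in> {1..m}" "a < d" "b < d"
    then show "(\<Sum>e<d. T e x y a b) = p_obs a b x y" unfolding T_def using P_sum by simp
  qed (rule total)
  also have "(\<Sum>e<d. \<Sum>a\<in>{..<d} - {e}. Q e xs a) = 1 - (\<Sum>e<d. Q e xs e)"
    by (simp add: sum_diff1 sum_subtractf total)
  also have "guessing_score d xs ys P \<le> (\<Sum>e<d. Q e xs e)"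
  proof -
    have "P e e' e e' xs ys \<le> (\<Sum>b<d. P e e' e b xs ys)" if "e < d" "e' < d" for e e'
      by (rule member_le_sum) (use D(1) that xs ys in simp_all)
    then have "guessing_score d xs ys P \<le> (\<Sum>e<d. \<Sum>e'<d. \<Sum>b<d. P e e' e b xs ys)"
      unfolding guessing_score_def by (intro sum_mono) auto
    also have "\<dots> = (\<Sum>e<d. Q e xs e)"
      unfolding Q_def T_def by (rule sum.cong[OF refl], rule sum.swap)
    finally show ?thesis .
  qed
  then have "8 * real m * (\<Sum>k<d. \<bar>\<alpha> k\<bar>) * (1 - (\<Sum>e<d. Q e xs e))
      \<le> 8 * real m * (\<Sum>k<d. \<bar>\<alpha> k\<bar>) * (1 - guessing_score d xs ys P)"
    by (intro mult_left_mono mult_nonneg_nonneg sum_nonneg) auto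
  finally show ?thesis by simp
qed

lemma guessing_families_nonempty:
  assumes "0 < d" and p_obs: "p_obs \<in> quantum_behaviors d m"
  shows "guessing_families d m p_obs \<noteq> {}"
proof -
  define P where "P e e' a b x y = (if e = 0 \<and> e' = 0 then p_obs a b x y else 0)"
    for e e' :: nat and a b x y
  have "\<exists>c\<ge>0. \<exists>q\<in>quantum_behaviors d m.
      \<forall>a<d. \<forall>b<d. \<forall>x\<in>{1..m}. \<forall>y\<in>{1..m}. P e e' a b x y = c * q a b x y" for e e'
    by (rule exI[of _ "if e = 0 \<and> e' = 0 then 1 else 0"], rule conjI, simp, rule bexI[OF _ p_obs])
      (simp add: P_def)
  moreover have "(\<Sum>e<d. \<Sum>e'<d. P e e' a b x y) = p_obs a b x y" for a b x y
  proof -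
    have "(\<Sum>e<d. \<Sum>e'<d. P e e' a b x y) = (\<Sum>e<d. if e = 0 then p_obs a b x y else 0)"
      using assms(1) by (intro sum.cong[OF refl]) (auto simp: P_def)
    then show ?thesis using assms(1) by simp
  qed
  ultimately have "P \<in> guessing_families d m p_obs" by (simp add: guessing_families_def)
  then show ?thesis by blast
qed

theorem mainTheorem3:
  fixes d m :: nat
  assumes "m \<ge> 2" and "d \<ge> 2"
  shows
    "(\<forall>xs\<in>{1..m}. \<forall>p_obs nA nB MA MB \<rho>.
        quantum_realization d m nA nB MA MB \<rho> p_obs \<longrightarrow>
        star_graph m xs \<subseteq> compatibility_structure d m nA MA \<longrightarrow>
        (\<forall>\<alpha>. chain_value d m \<alpha> p_obs \<le> classical_bound d m \<alpha>))
   \<and> (\<forall>p_obs\<in>quantum_behaviors d m.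
        (\<exists>\<alpha>. chain_value d m \<alpha> p_obs > classical_bound d m \<alpha>) \<longrightarrow>
        (\<forall>xs\<in>{1..m}. \<forall>ys\<in>{1..m}.
           P_guess_NL d m p_obs xs ys < 1
         \<and> \<not> (\<exists>P\<in>guessing_families d m p_obs. guessing_score d xs ys P = 1)))"
proof -
  have d: "0 < d" using assms by simp
  have "P_guess_NL d m p_obs xs ys < 1 \<and> \<not> (\<exists>P\<in>guessing_families d m p_obs. guessing_score d xs ys P = 1)"
    if p_obs: "p_obs \<in> quantum_behaviors d m"
      and violation: "chain_value d m \<alpha> p_obs > classical_bound d m \<alpha>"
      and xs: "xs \<in> {1..m}" and ys: "ys \<in> {1..m}" for p_obs \<alpha> xs ys
  proof -
    define gap where "gap = chain_value d m \<alpha> p_obs - classical_bound d m \<alpha>"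
    define K where "K = 8 * real m * (\<Sum>k<d. \<bar>\<alpha> k\<bar>)"
    have gap: "0 < gap" using violation by (simp add: gap_def)
    have K: "0 \<le> K" unfolding K_def by (intro mult_nonneg_nonneg sum_nonneg) auto
    have score: "guessing_score d xs ys P \<le> 1 - gap / (K + 1)" if "P \<in> guessing_families d m p_obs" for P
    proof -
      have le: "gap \<le> K * (1 - guessing_score d xs ys P)"
        using chain_value_le_guessing[OF d xs ys p_obs that, of \<alpha>] by (simp add: gap_def K_def)
      then have "0 < 1 - guessing_score d xs ys P"
        using gap mult_nonneg_nonpos[OF K, of "1 - guessing_score d xs ys P"] by linarith
      then have "gap \<le> (K + 1) * (1 - guessing_score d xs ys P)"
        using le by (simp add: distrib_right)
      then have "gap / (K + 1) \<le> 1 - guessing_score d xs ys P"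
        using K by (simp add: pos_divide_le_eq mult.commute)
      then show ?thesis by simp
    qed
    then have "P_guess_NL d m p_obs xs ys \<le> 1 - gap / (K + 1)"
      unfolding P_guess_NL_def by (intro cSUP_least guessing_families_nonempty[OF d p_obs])
    moreover have "0 < gap / (K + 1)" using gap K by simp
    ultimately have "P_guess_NL d m p_obs xs ys < 1"
      and "guessing_score d xs ys P \<noteq> 1" if "P \<in> guessing_families d m p_obs" for P
      using score[OF that] by linarith+
    then show ?thesis using guessing_families_nonempty[OF d p_obs] by blast
  qed
  moreover have "chain_value d m \<alpha> p_obs \<le> classical_bound d m \<alpha>"
    if "xs \<in> {1..m}" "quantum_realization d m nA nB MA MB \<rho> p_obs"
      "star_graph m xs \<subseteq> compatibility_structure d m nA MA" for xs p_obs nA nB MA MB \<rho> \<alpha>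
    using star_compatible_chain_value_le[OF d that] .
  ultimately show ?thesis by (intro conjI ballI allI impI; (elim exE)?) simp_all
qed

end
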